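(* Let $\theta^\star\in\mathbb{R}^p$ be a global minimum of $\mathcal{L}$ (so $\mathcal{L}(\theta^\star)=0$). Let $\eta>0$, $\rho\ge0$, $B\ge1$ be the learning rate, perturbation radius and batch size of stochastic SAM. Suppose there exists $\gamma>0$ such that $$\operatorname{Tr}\big(\Sigma(\theta)G(\theta)\big)\;\ge\;2\gamma\,\mathcal{L}(\theta)\,\|G(\theta)\|_F^2\qquad\text{for all }\theta\in\mathbb{R}^p ,$$ and that $$\|H(\theta^\star)\|_F^2\left(1+\frac{\rho^2\gamma}{B}\|H(\theta^\star)\|_F^2\right)>\frac{B}{\eta^2\gamma}.$$ Then $\theta^\star$ is not linearly stable for SAM. Indeed, there is a constant $C>1$ such that the iterates of stochastic SAM run on the linearized loss at $\theta^\star$ satisfy $$\mathbb{E}[\mathcal{L}_{\rm lin}(\theta^t)]\ge C^t\,\mathbb{E}[\mathcal{L}_{\rm lin}(\theta^0)]\qquad\text{for all }t>0 .$$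
   Context: **Model and loss.** Training data $(x_i,y_i)_{i=1}^n$ with $x_i\in\mathbb{R}^d$, $y_i\in\mathbb{R}$; a model $f(x;\theta)\in\mathbb{R}$ with parameters $\theta\in\mathbb{R}^p$, where each $\theta\mapsto f(x_i;\theta)$ is twice differentiable. $\ell_i(\theta)=\frac12|f(x_i;\theta)-y_i|^2$ and $\mathcal{L}(\theta)=\frac1n\sum_{i=1}^n\ell_i(\theta)$. The over-parameterized case is assumed: $\min_\theta\mathcal{L}(\theta)=0$. **Matrices.** $G(\theta)=\frac1n\sum_{i=1}^n\nabla f(x_i;\theta)\nabla f(x_i;\theta)^\top$ (Fisher matrix); $H(\theta)=G(\theta)+\frac1n\sum_{i=1}^n(f(x_i;\theta)-y_i)\nabla^2f(x_i;\theta)$ (the Hessian of $\mathcal{L}$). $\Sigma(\theta)=\frac1n\sum_{i=1}^n(\nabla\ell_i(\theta)-\nabla\mathcal{L}(\theta))(\nabla\ell_i(\theta)-\nabla\mathcal{L}(\theta))^\top$ (gradient noise covariance). $\|\cdot\|_F$ is the Frobenius norm. **Stochastic SAM.** For a loss that is an average of per-sample losses $\ell_1,\dots,\ell_n$ and a batch $\xi=(\xi_1,\dots,\xi_B)$ of indices in $\{1,\dots,n\}$, put $\mathcal{L}_\xi(\theta)=\frac1B\sum_{j=1}^B\ell_{\xi_j}(\theta)$. Stochastic SAM is the iteration $$\theta^{t+1}=\theta^t-\eta\nabla\mathcal{L}_{\xi_t^1}\big(\theta^t+\rho\nabla\mathcal{L}_{\xi_t^2}(\theta^t)\big),\qquad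 t=0,1,2,\dots,$$ where all batches $\xi_t^1,\xi_t^2$ ($t\ge0$) are mutually independent and each consists of $B$ indices drawn independently and uniformly from $\{1,\dots,n\}$. Expectations $\mathbb{E}$ are over these random batches. **Linear stability.** The linearized model at $\theta^\star$ is $f_{\rm lin}(x;\theta)=f(x;\theta^\star)+\langle\nabla f(x;\theta^\star),\theta-\theta^\star\rangle$, with linearized loss $\mathcal{L}_{\rm lin}(\theta)=\frac{1}{2n}\sum_{i=1}^n(f_{\rm lin}(x_i;\theta)-y_i)^2$. The global minimum $\theta^\star$ is called linearly stable for SAM if there exists $C>0$ such that, when stochastic SAM is run on the linearized loss $\mathcal{L}_{\rm lin}$ (with per-sample losses $\frac12(f_{\rm lin}(x_i;\theta)-y_i)^2$) from any initial point $\theta^0$ in a neighbourhood of $\theta^\star$, one has $\mathbb{E}[\mathcal{L}_{\rm lin}(\theta^t)]\le C\,\mathbb{E}[\mathcal{L}_{\rm lin}(\theta^0)]$ for all $t\ge0$. In the escape estimate of the claim, $\theta^0$ is likewise any such initial point and $C$ does not depend on it. *)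

theory Defs
  imports "HOL-Probability.Probability"
begin

definition gradient :: "(real ^ 'p \<Rightarrow> real) \<Rightarrow> real ^ 'p \<Rightarrow> real ^ 'p" where
  "gradient F \<theta> = (THE D. GDERIV F \<theta> :> D)"

definition hessian :: "(real ^ 'p \<Rightarrow> real) \<Rightarrow> real ^ 'p \<Rightarrow> real ^ 'p ^ 'p" where
  "hessian F \<theta> = jacobian (gradient F) (at \<theta>)"

definition twice_differentiable :: "(real ^ 'p \<Rightarrow> real) \<Rightarrow> bool" where
  "twice_differentiable F \<longleftrightarrow>
     (\<forall>\<theta>. F differentiable (at \<theta>)) \<and> (\<forall>\<theta>. gradient F differentiable (at \<theta>))"

definition outer_prod :: "real ^ 'p \<Rightarrow> real ^ 'p \<Rightarrow> real ^ 'p ^ 'p" where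
  "outer_prod u v = (\<chi> i j. u $ i * v $ j)"

definition frobenius_norm :: "real ^ 'p ^ 'p \<Rightarrow> real" where
  "frobenius_norm A = sqrt (\<Sum>i\<in>UNIV. \<Sum>j\<in>UNIV. (A $ i $ j)\<^sup>2)"

text \<open>
  A model is a function \<open>f\<close> of an input and a parameter.  The training data are \<open>(x i, y i)\<close>
  for \<open>i \<in> {1..n}\<close>; the values of \<open>x\<close> and \<open>y\<close> elsewhere are irrelevant.
\<close>

definition sample_loss ::
  "('x \<Rightarrow> real ^ 'p \<Rightarrow> real) \<Rightarrow> (nat \<Rightarrow> 'x) \<Rightarrow> (nat \<Rightarrow> real) \<Rightarrow> nat \<Rightarrow> real ^ 'p \<Rightarrow> real" where
  "sample_loss f x y i \<theta> = 1 / 2 * \<bar>f (x i) \<theta> - y i\<bar>\<^sup>2"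

definition loss ::
  "nat \<Rightarrow> ('x \<Rightarrow> real ^ 'p \<Rightarrow> real) \<Rightarrow> (nat \<Rightarrow> 'x) \<Rightarrow> (nat \<Rightarrow> real) \<Rightarrow> real ^ 'p \<Rightarrow> real" where
  "loss n f x y \<theta> = 1 / real n * (\<Sum>i = 1..n. sample_loss f x y i \<theta>)"

definition fisher_matrix ::
  "nat \<Rightarrow> ('x \<Rightarrow> real ^ 'p \<Rightarrow> real) \<Rightarrow> (nat \<Rightarrow> 'x) \<Rightarrow> real ^ 'p \<Rightarrow> real ^ 'p ^ 'p" where
  "fisher_matrix n f x \<theta> =
     (1 / real n) *\<^sub>R (\<Sum>i = 1..n. outer_prod (gradient (f (x i)) \<theta>) (gradient (f (x i)) \<theta>))"

definition loss_hessian ::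
  "nat \<Rightarrow> ('x \<Rightarrow> real ^ 'p \<Rightarrow> real) \<Rightarrow> (nat \<Rightarrow> 'x) \<Rightarrow> (nat \<Rightarrow> real) \<Rightarrow>
   real ^ 'p \<Rightarrow> real ^ 'p ^ 'p" where
  "loss_hessian n f x y \<theta> = fisher_matrix n f x \<theta> +
     (1 / real n) *\<^sub>R (\<Sum>i = 1..n. (f (x i) \<theta> - y i) *\<^sub>R hessian (f (x i)) \<theta>)"

definition noise_covariance ::
  "nat \<Rightarrow> ('x \<Rightarrow> real ^ 'p \<Rightarrow> real) \<Rightarrow> (nat \<Rightarrow> 'x) \<Rightarrow> (nat \<Rightarrow> real) \<Rightarrow>
   real ^ 'p \<Rightarrow> real ^ 'p ^ 'p" where
  "noise_covariance n f x y \<theta> =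
     (1 / real n) *\<^sub>R (\<Sum>i = 1..n. outer_prod
        (gradient (sample_loss f x y i) \<theta> - gradient (loss n f x y) \<theta>)
        (gradient (sample_loss f x y i) \<theta> - gradient (loss n f x y) \<theta>))"

definition linearized_model ::
  "('x \<Rightarrow> real ^ 'p \<Rightarrow> real) \<Rightarrow> real ^ 'p \<Rightarrow> 'x \<Rightarrow> real ^ 'p \<Rightarrow> real" where
  "linearized_model f \<theta>s = (\<lambda>x \<theta>. f x \<theta>s + gradient (f x) \<theta>s \<bullet> (\<theta> - \<theta>s))"

text \<open>A batch is a list of indices; its size is the length of the list.\<close>

definition batch_loss :: "(nat \<Rightarrow> real ^ 'p \<Rightarrow> real) \<Rightarrow> nat list \<Rightarrow> real ^ 'p \<Rightarrow> real" where
  "batch_loss ls \<xi> \<theta> = 1 / real (length \<xi>) * (\<Sum>i\<leftarrow>\<xi>. ls i \<theta>)"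

text \<open>
  A sample point \<open>\<omega>\<close> assigns to each time \<open>t\<close> the pair \<open>\<omega> t\<close> of the outer batch (the one at
  which the update gradient is taken) and the inner batch (the one used for the perturbation).
\<close>

primrec sam_iterate ::
  "(nat \<Rightarrow> real ^ 'p \<Rightarrow> real) \<Rightarrow> real \<Rightarrow> real \<Rightarrow> real ^ 'p \<Rightarrow>
   (nat \<Rightarrow> nat list \<times> nat list) \<Rightarrow> nat \<Rightarrow> real ^ 'p" where
  "sam_iterate ls \<eta> \<rho> \<theta>0 \<omega> 0 = \<theta>0"
| "sam_iterate ls \<eta> \<rho> \<theta>0 \<omega> (Suc t) =
     (let \<theta> = sam_iterate ls \<eta> \<rho> \<theta>0 \<omega> t; \<xi>1 = fst (\<omega> t); \<xi>2 = snd (\<omega> t)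
      in \<theta> - \<eta> *\<^sub>R gradient (batch_loss ls \<xi>1) (\<theta> + \<rho> *\<^sub>R gradient (batch_loss ls \<xi>2) \<theta>))"

definition batch_pmf :: "nat \<Rightarrow> nat \<Rightarrow> nat list pmf" where
  "batch_pmf n B = replicate_pmf B (pmf_of_set {1..n})"

text \<open>The product measure makes all the batches, inner and outer at all times, independent.\<close>

definition batch_space :: "nat \<Rightarrow> nat \<Rightarrow> (nat \<Rightarrow> nat list \<times> nat list) measure" where
  "batch_space n B =
     (\<Pi>\<^sub>M t\<in>UNIV. measure_pmf (pair_pmf (batch_pmf n B) (batch_pmf n B)))"

text \<open>
  The expectation of the linearized loss at \<open>\<theta>s\<close> after \<open>t\<close> steps of stochastic SAM on that
  linearized loss, started at the point \<open>\<theta>0\<close>.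
\<close>

definition expected_lin_loss ::
  "nat \<Rightarrow> ('x \<Rightarrow> real ^ 'p \<Rightarrow> real) \<Rightarrow> (nat \<Rightarrow> 'x) \<Rightarrow> (nat \<Rightarrow> real) \<Rightarrow> real ^ 'p \<Rightarrow>
   real \<Rightarrow> real \<Rightarrow> nat \<Rightarrow> real ^ 'p \<Rightarrow> nat \<Rightarrow> real" where
  "expected_lin_loss n f x y \<theta>s \<eta> \<rho> B \<theta>0 t =
     (LINT \<omega>|batch_space n B. loss n (linearized_model f \<theta>s) x y
        (sam_iterate (sample_loss (linearized_model f \<theta>s) x y) \<eta> \<rho> \<theta>0 \<omega> t))"

definition linearly_stable ::
  "nat \<Rightarrow> ('x \<Rightarrow> real ^ 'p \<Rightarrow> real) \<Rightarrow> (nat \<Rightarrow> 'x) \<Rightarrow> (nat \<Rightarrow> real) \<Rightarrow> real ^ 'p \<Rightarrow>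
   real \<Rightarrow> real \<Rightarrow> nat \<Rightarrow> bool" where
  "linearly_stable n f x y \<theta>s \<eta> \<rho> B \<longleftrightarrow>
     (\<exists>C>0. \<exists>U. open U \<and> \<theta>s \<in> U \<and>
        (\<forall>\<theta>0\<in>U. \<forall>t. expected_lin_loss n f x y \<theta>s \<eta> \<rho> B \<theta>0 t
                      \<le> C * expected_lin_loss n f x y \<theta>s \<eta> \<rho> B \<theta>0 0))"

end

theory Submission
  imports Defs
begin

text \<open>
  Write \<open>a i\<close> for the gradient of \<open>f (x i)\<close> at \<open>\<theta>s\<close> and \<open>G\<close> for the Fisher matrix there.  As the
  residuals vanish at \<open>\<theta>s\<close>, \<open>G\<close> is the Hessian, the linearized loss at \<open>\<theta>s + v\<close> is half the form
  \<open>Q v = (v, G v)\<close>, and a SAM step maps \<open>v\<close> to \<open>v - \<eta> G\<^sub>1 (v + \<rho> G\<^sub>2 v)\<close> with the empirical Fisher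
  matrices \<open>G\<^sub>1\<close>, \<open>G\<^sub>2\<close> of the two batches.  Splitting each batch average into its mean and its
  fluctuation, and keeping only the fluctuation for \<open>G\<^sub>1\<close>, bounds the expectation of \<open>Q\<close> after
  one step from below by \<open>C (Q v)\<close> with \<open>C > 1\<close>: the noise condition bounds both fluctuations, and
  \<open>Q (v + \<rho> G v) \<ge> Q v\<close>.  Conditioning on the first step and induction on time give
  the growth \<open>C ^ t\<close>.
\<close>

subsection \<open>Orbits of independent random maps\<close>

text \<open>An abstract counterpart of \<open>sam_iterate\<close>: any step map \<open>h\<close> on
  any state type, where step \<open>t\<close> reads coordinate \<open>t\<close> of the
  noise.\<close>

primrec random_orbit :: "('b \<Rightarrow> 'a \<Rightarrow> 'b) \<Rightarrow> 'b \<Rightarrow> (nat \<Rightarrow> 'a) \<Rightarrow> nat \<Rightarrow> 'b" where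
  "random_orbit h z \<omega> 0 = z"
| "random_orbit h z \<omega> (Suc t) = h (random_orbit h z \<omega> t) (\<omega> t)"

text \<open>The recursion peels off the last step, whereas conditioning needs the first one:
  prepending \<open>s\<close> to the noise amounts to starting from \<open>h z s\<close>.\<close>

lemma random_orbit_case_nat:
  "random_orbit h z (case_nat s \<omega>) (Suc t) = random_orbit h (h z s) \<omega> t"
  by (induction t) auto

text \<open>Each noise coordinate lives on a countable discrete space, so \<open>h\<close> and
  \<open>F\<close> may be arbitrary. Generalizing over \<open>F\<close> lets the induction absorb
  the last step into the test function.\<close>

lemma measurable_random_orbit:
  fixes p :: "'a :: countable pmf"
  shows "(\<lambda>\<omega>. F (random_orbit h z \<omega> t)) \<in> borel_measurable (PiM UNIV (\<lambda>_::nat. measure_pmf p))"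
proof (induction t arbitrary: F)
  case (Suc t)
  have sel: "(\<lambda>\<omega>. \<omega> t) \<in> PiM UNIV (\<lambda>_::nat. measure_pmf p) \<rightarrow>\<^sub>M count_space UNIV"
    using measurable_component_singleton[of t UNIV "\<lambda>_::nat. measure_pmf p"] by simp
  show ?case
    using measurable_compose_countable[OF Suc.IH[of "\<lambda>w. F (h w s)" for s] sel] by simp
qed simp

text \<open>By \<open>PiM_iter\<close>, the law of an independent sequence is the image under
  prepending of the product of \<open>p\<close> with that same law; Tonelli's theorem then separates
  the first coordinate.\<close>

lemma nn_integral_random_orbit_Suc:
  fixes p :: "'a :: countable pmf" and F :: "'b \<Rightarrow> ennreal"
  shows "(\<integral>\<^sup>+\<omega>. F (random_orbit h z \<omega> (Suc t)) \<partial>PiM UNIV (\<lambda>_::nat. measure_pmf p)) =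
         (\<integral>\<^sup>+s. \<integral>\<^sup>+\<omega>. F (random_orbit h (h z s) \<omega> t) \<partial>PiM UNIV (\<lambda>_::nat. measure_pmf p) \<partial>measure_pmf p)"
proof -
  interpret sequence_space "measure_pmf p" by unfold_locales
  have meas: "(\<lambda>\<omega>. F (random_orbit h z \<omega> (Suc t))) \<in> borel_measurable S"
    by (rule measurable_random_orbit)
  have cn: "(\<lambda>(s, \<omega>). case_nat s \<omega>) \<in> measure_pmf p \<Otimes>\<^sub>M S \<rightarrow>\<^sub>M S"
    by measurable
  have "(\<integral>\<^sup>+\<omega>. F (random_orbit h z \<omega> (Suc t)) \<partial>S) =
        (\<integral>\<^sup>+\<omega>. F (random_orbit h z \<omega> (Suc t)) \<partial>distr (measure_pmf p \<Otimes>\<^sub>M S) S (\<lambda>(s, \<omega>). case_nat s \<omega>))"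
    by (simp only: PiM_iter)
  also have "\<dots> = (\<integral>\<^sup>+u. F (random_orbit h z (case u of (s, \<omega>) \<Rightarrow> case_nat s \<omega>) (Suc t)) \<partial>(measure_pmf p \<Otimes>\<^sub>M S))"
    by (rule nn_integral_distr[OF cn]) (use meas in simp)
  also have "\<dots> = (\<integral>\<^sup>+s. \<integral>\<^sup>+\<omega>. F (random_orbit h z (case_nat s \<omega>) (Suc t)) \<partial>S \<partial>measure_pmf p)"
    by (subst P.nn_integral_fst[symmetric])
       (use measurable_compose[OF cn meas] in \<open>simp_all add: case_prod_beta'\<close>)
  finally show ?thesis by (simp only: random_orbit_case_nat)
qed

text \<open>With finite support, each conditioning step is a finite sum of finite values.\<close>

lemma nn_integral_random_orbit_finite:
  fixes p :: "'a :: countable pmf" and L :: "'b \<Rightarrow> real"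
  assumes "finite (set_pmf p)"
  shows "(\<integral>\<^sup>+\<omega>. ennreal (L (random_orbit h z \<omega> t)) \<partial>PiM UNIV (\<lambda>_::nat. measure_pmf p)) < \<infinity>"
proof (induction t arbitrary: z)
  case 0
  interpret sequence_space "measure_pmf p" by unfold_locales
  show ?case by (simp add: P.emeasure_space_1)
next
  case (Suc t)
  show ?case
    unfolding nn_integral_random_orbit_Suc[where F = "\<lambda>z. ennreal (L z)"]
    using assms Suc by (simp add: nn_integral_measure_pmf_finite ennreal_mult_less_top)
qed

text \<open>One-step growth from every state compounds: condition on the first step and apply the
  induction hypothesis from the new state. The induction runs in \<open>ennreal\<close>, which
  postpones integrability to the end.\<close>

lemma expectation_random_orbit_ge:
  fixes p :: "'a :: countable pmf" and L :: "'b \<Rightarrow> real"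
  assumes fin: "finite (set_pmf p)" and nonneg: "\<And>z. L z \<ge> 0" and "C \<ge> 0"
    and step: "\<And>z. C * L z \<le> measure_pmf.expectation p (\<lambda>s. L (h z s))"
  shows "C ^ t * L z \<le> (LINT \<omega>|PiM UNIV (\<lambda>_::nat. measure_pmf p). L (random_orbit h z \<omega> t))"
proof -
  interpret sequence_space "measure_pmf p" by unfold_locales
  have le: "ennreal (C ^ t * L z) \<le> (\<integral>\<^sup>+\<omega>. ennreal (L (random_orbit h z \<omega> t)) \<partial>S)"
  proof (induction t arbitrary: z)
    case 0
    show ?case by (simp add: P.emeasure_space_1)
  next
    case (Suc t)
    have "C ^ Suc t * L z \<le> C ^ t * measure_pmf.expectation p (\<lambda>s. L (h z s))"
      using mult_left_mono[OF step, of "C ^ t"] \<open>C \<ge> 0\<close> by (simp add: mult_ac)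
    also have "\<dots> = measure_pmf.expectation p (\<lambda>s. C ^ t * L (h z s))" by simp
    finally have "ennreal (C ^ Suc t * L z) \<le> ennreal (measure_pmf.expectation p (\<lambda>s. C ^ t * L (h z s)))"
      by (rule ennreal_leI)
    also have "\<dots> = (\<integral>\<^sup>+s. ennreal (C ^ t * L (h z s)) \<partial>measure_pmf p)"
      by (rule nn_integral_eq_integral[symmetric])
         (use fin nonneg \<open>C \<ge> 0\<close> in \<open>auto intro: integrable_measure_pmf_finite\<close>)
    also have "\<dots> \<le> (\<integral>\<^sup>+s. \<integral>\<^sup>+\<omega>. ennreal (L (random_orbit h (h z s) \<omega> t)) \<partial>S \<partial>measure_pmf p)"
      by (intro nn_integral_mono Suc.IH)
    finally show ?case unfolding nn_integral_random_orbit_Suc[where F = "\<lambda>z. ennreal (L z)"] .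
  qed
  \<comment> \<open>A Bochner integral defaults to \<open>0\<close> on non-integrable functions, so
    integrability must precede the transfer of the lower bound.\<close>
  have "integrable S (\<lambda>\<omega>. L (random_orbit h z \<omega> t))"
    by (rule integrableI_nonneg)
       (use measurable_random_orbit nonneg nn_integral_random_orbit_finite[OF fin] in auto)
  then have "(\<integral>\<^sup>+\<omega>. ennreal (L (random_orbit h z \<omega> t)) \<partial>S) = ennreal (LINT \<omega>|S. L (random_orbit h z \<omega> t))"
    by (rule nn_integral_eq_integral) (use nonneg in auto)
  with le show ?thesis
    by (simp add: ennreal_le_iff nonneg integral_nonneg_AE)
qed

text \<open>Fubini for finitely supported laws. The second component is integrated last: the inner
  batch stays fixed while the outer one is averaged.\<close>

lemma expectation_pair_pmf_finite:
  fixes f :: "'a \<times> 'b \<Rightarrow> real"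
  assumes "finite (set_pmf p)" "finite (set_pmf q)"
  shows "measure_pmf.expectation (pair_pmf p q) f =
         measure_pmf.expectation q (\<lambda>b. measure_pmf.expectation p (\<lambda>a. f (a, b)))"
proof -
  have "measure_pmf.expectation (pair_pmf p q) f =
        (\<Sum>u\<in>set_pmf p \<times> set_pmf q. f u * pmf (pair_pmf p q) u)"
    using assms by (intro integral_measure_pmf_real) auto
  also have "\<dots> = (\<Sum>a\<in>set_pmf p. \<Sum>b\<in>set_pmf q. f (a, b) * (pmf p a * pmf q b))"
    by (auto simp: sum.cartesian_product pmf_pair intro!: sum.cong)
  also have "\<dots> = (\<Sum>b\<in>set_pmf q. (\<Sum>a\<in>set_pmf p. f (a, b) * pmf p a) * pmf q b)"
    by (subst sum.swap) (simp add: sum_distrib_left mult_ac)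
  also have "\<dots> = measure_pmf.expectation q (\<lambda>b. measure_pmf.expectation p (\<lambda>a. f (a, b)))"
    using assms by (simp add: integral_measure_pmf_real)
  finally show ?thesis .
qed

subsection \<open>Batch averages and one step of SAM\<close>

text \<open>Vector-valued, so that one notion covers scalars, gradients and matrices.\<close>

definition sample_avg :: "nat \<Rightarrow> (nat \<Rightarrow> 'b :: real_vector) \<Rightarrow> 'b" where
  "sample_avg n g = (1 / real n) *\<^sub>R (\<Sum>i = 1..n. g i)"

lemma sample_avg_add: "sample_avg n (\<lambda>i. g i + h i) = sample_avg n g + sample_avg n h"
  by (simp add: sample_avg_def sum.distrib algebra_simps)

lemma sample_avg_cmult: "sample_avg n (\<lambda>i. c * g i) = c * (sample_avg n g :: real)"
  by (simp add: sample_avg_def sum_distrib_left mult_ac)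

lemma sample_avg_const: "n \<ge> 1 \<Longrightarrow> sample_avg n (\<lambda>_. c) = c"
  by (simp add: sample_avg_def sum_constant_scaleR del: sum_constant)

lemma sample_avg_cong:
  "(\<And>i. i \<in> {1..n} \<Longrightarrow> g i = h i) \<Longrightarrow> sample_avg n g = sample_avg n h"
  unfolding sample_avg_def by (auto intro!: arg_cong[of _ _ "scaleR _"] sum.cong)

lemma sample_avg_mono:
  fixes g :: "nat \<Rightarrow> real"
  shows "(\<And>i. i \<in> {1..n} \<Longrightarrow> g i \<le> h i) \<Longrightarrow> sample_avg n g \<le> sample_avg n h"
  unfolding sample_avg_def by (auto intro!: divide_right_mono sum_mono)

lemma sample_avg_nonneg:
  fixes g :: "nat \<Rightarrow> real"
  shows "(\<And>i. i \<in> {1..n} \<Longrightarrow> 0 \<le> g i) \<Longrightarrow> 0 \<le> sample_avg n g"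
  unfolding sample_avg_def by (intro scaleR_nonneg_nonneg sum_nonneg) auto

lemma inner_sample_avg_right: "v \<bullet> sample_avg n g = sample_avg n (\<lambda>i. v \<bullet> g i)"
  by (simp add: sample_avg_def inner_sum_right)

lemma sample_avg_swap:
  "sample_avg n (\<lambda>i. sample_avg m (g i)) = sample_avg m (\<lambda>j. sample_avg n (\<lambda>i. g i j))"
  unfolding sample_avg_def by (simp add: scaleR_sum_right, subst sum.swap, simp add: mult.commute)

text \<open>Second moment equals squared mean plus variance: deviations from the mean average to
  zero, which removes the cross term.\<close>

lemma sample_avg_square_affine:
  fixes h :: "nat \<Rightarrow> real"
  assumes "n \<ge> 1"
  shows "sample_avg n (\<lambda>i. (\<alpha> + s * h i)\<^sup>2) =
         (\<alpha> + s * sample_avg n h)\<^sup>2 + s\<^sup>2 * sample_avg n (\<lambda>i. (h i - sample_avg n h)\<^sup>2)"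
proof -
  define m where "m = sample_avg n h"
  have z: "sample_avg n (\<lambda>i. h i - m) = 0"
    using sample_avg_add[of n h "\<lambda>_. - m"] assms by (simp add: sample_avg_const m_def)
  have "sample_avg n (\<lambda>i. (\<alpha> + s * h i)\<^sup>2) =
        sample_avg n (\<lambda>i. (\<alpha> + s * m)\<^sup>2 + (2 * (\<alpha> + s * m) * s * (h i - m) + s\<^sup>2 * (h i - m)\<^sup>2))"
    by (rule arg_cong[of _ _ "sample_avg n"]) (auto simp: fun_eq_iff power2_eq_square algebra_simps)
  also have "\<dots> = (\<alpha> + s * m)\<^sup>2 + s\<^sup>2 * sample_avg n (\<lambda>i. (h i - m)\<^sup>2)"
    using assms by (simp add: sample_avg_add sample_avg_cmult sample_avg_const z)
  finally show ?thesis by (simp add: m_def)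
qed

section \<open>Second moments of random batches\<close>

lemma finite_set_batch_pmf: "n \<ge> 1 \<Longrightarrow> finite (set_pmf (batch_pmf n B))"
  by (auto simp: batch_pmf_def set_replicate_pmf intro: finite_subset[OF _ finite_lists_length_eq[of "{1..n}" B]])

lemma set_batch_pmf: "n \<ge> 1 \<Longrightarrow> set_pmf (batch_pmf n B) = {\<xi>. set \<xi> \<subseteq> {1..n} \<and> length \<xi> = B}"
  by (auto simp: batch_pmf_def set_replicate_pmf)

lemma expectation_batch_Suc:
  fixes F :: "nat list \<Rightarrow> real"
  assumes "n \<ge> 1"
  shows "measure_pmf.expectation (batch_pmf n (Suc B)) F =
         sample_avg n (\<lambda>i. measure_pmf.expectation (batch_pmf n B) (\<lambda>\<xi>. F (i # \<xi>)))"
proof -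
  have eq: "batch_pmf n (Suc B) = pmf_of_set {1..n} \<bind> (\<lambda>i. map_pmf ((#) i) (batch_pmf n B))"
    by (simp add: batch_pmf_def map_pmf_def)
  show ?thesis
    unfolding eq using assms
    by (subst pmf_expectation_bind_pmf_of_set)
       (auto simp: finite_set_batch_pmf sample_avg_def sum_distrib_left divide_inverse)
qed

text \<open>Variances of independent indices add up. The offset \<open>\<alpha>\<close> is arbitrary
  because the induction moves the contribution \<open>s * h i\<close> of the first index into
  it.\<close>

lemma expectation_batch_square:
  fixes h :: "nat \<Rightarrow> real"
  assumes "n \<ge> 1"
  shows "measure_pmf.expectation (batch_pmf n B) (\<lambda>\<xi>. (\<alpha> + s * (\<Sum>i\<leftarrow>\<xi>. h i))\<^sup>2) =
         (\<alpha> + s * real B * sample_avg n h)\<^sup>2 +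
         s\<^sup>2 * real B * sample_avg n (\<lambda>i. (h i - sample_avg n h)\<^sup>2)"
proof (induction B arbitrary: \<alpha>)
  case 0
  show ?case by (simp add: batch_pmf_def)
next
  case (Suc B)
  let ?m = "sample_avg n h" and ?V = "sample_avg n (\<lambda>i. (h i - sample_avg n h)\<^sup>2)"
  have "measure_pmf.expectation (batch_pmf n (Suc B)) (\<lambda>\<xi>. (\<alpha> + s * (\<Sum>i\<leftarrow>\<xi>. h i))\<^sup>2) =
        sample_avg n (\<lambda>i. ((\<alpha> + s * real B * ?m) + s * h i)\<^sup>2 + s\<^sup>2 * real B * ?V)"
    using Suc[of "\<alpha> + s * h i" for i]
    by (simp add: expectation_batch_Suc[OF assms] algebra_simps)
  also have "\<dots> = (\<alpha> + s * real B * ?m + s * ?m)\<^sup>2 + s\<^sup>2 * ?V + s\<^sup>2 * real B * ?V"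
    using assms by (simp add: sample_avg_add sample_avg_const sample_avg_square_affine)
  finally show ?case by (simp add: algebra_simps)
qed

text \<open>The quadratic form \<open>(v, G v)\<close> of the Fisher matrix \<open>G\<close> with
  sample gradients \<open>a\<close>.\<close>

definition fisher_form :: "nat \<Rightarrow> (nat \<Rightarrow> 'a :: real_inner) \<Rightarrow> 'a \<Rightarrow> real" where
  "fisher_form n a v = sample_avg n (\<lambda>k. (a k \<bullet> v)\<^sup>2)"

lemma fisher_form_nonneg: "0 \<le> fisher_form n a v"
  unfolding fisher_form_def by (intro sample_avg_nonneg) simp

lemma inner_sum_list_right: "v \<bullet> (\<Sum>i\<leftarrow>\<xi>. g i) = (\<Sum>i\<leftarrow>\<xi>. v \<bullet> g i)"
  by (induction \<xi>) (auto simp: inner_add_right)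

text \<open>The form averages squares of linear functionals, so
  \<open>expectation_batch_square\<close> applies to each \<open>a k\<close> separately.\<close>

lemma expectation_batch_fisher_form:
  assumes "n \<ge> 1"
  shows "measure_pmf.expectation (batch_pmf n B) (\<lambda>\<xi>. fisher_form n a (u + s *\<^sub>R (\<Sum>i\<leftarrow>\<xi>. g i))) =
         fisher_form n a (u + (s * real B) *\<^sub>R sample_avg n g) +
         s\<^sup>2 * real B * sample_avg n (\<lambda>i. fisher_form n a (g i - sample_avg n g))"
proof -
  have "measure_pmf.expectation (batch_pmf n B) (\<lambda>\<xi>. fisher_form n a (u + s *\<^sub>R (\<Sum>i\<leftarrow>\<xi>. g i))) =
        sample_avg n (\<lambda>k. measure_pmf.expectation (batch_pmf n B)
          (\<lambda>\<xi>. (a k \<bullet> u + s * (\<Sum>i\<leftarrow>\<xi>. a k \<bullet> g i))\<^sup>2))"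
    unfolding fisher_form_def sample_avg_def
    by (simp add: inner_add_right inner_sum_list_right)
       (subst Bochner_Integration.integral_sum,
        auto intro: integrable_measure_pmf_finite finite_set_batch_pmf[OF assms])
  also have "\<dots> = sample_avg n (\<lambda>k. (a k \<bullet> (u + (s * real B) *\<^sub>R sample_avg n g))\<^sup>2 +
      s\<^sup>2 * real B * sample_avg n (\<lambda>i. (a k \<bullet> (g i - sample_avg n g))\<^sup>2))"
    by (simp add: expectation_batch_square[OF assms] inner_add_right inner_diff_right inner_sample_avg_right)
  also have "\<dots> = fisher_form n a (u + (s * real B) *\<^sub>R sample_avg n g) +
         s\<^sup>2 * real B * sample_avg n (\<lambda>k. sample_avg n (\<lambda>i. (a k \<bullet> (g i - sample_avg n g))\<^sup>2))"
    by (simp add: sample_avg_add sample_avg_cmult fisher_form_def)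
  also have "sample_avg n (\<lambda>k. sample_avg n (\<lambda>i. (a k \<bullet> (g i - sample_avg n g))\<^sup>2)) =
      sample_avg n (\<lambda>i. fisher_form n a (g i - sample_avg n g))"
    unfolding fisher_form_def by (rule sample_avg_swap)
  finally show ?thesis .
qed

text \<open>
  For residuals \<open>r\<close> and model gradients \<open>a\<close>, the trace of the gradient noise covariance
  against the Fisher matrix.
\<close>

definition noise_energy :: "nat \<Rightarrow> (nat \<Rightarrow> 'a :: real_inner) \<Rightarrow> (nat \<Rightarrow> real) \<Rightarrow> real" where
  "noise_energy n a r =
     sample_avg n (\<lambda>i. fisher_form n a (r i *\<^sub>R a i - sample_avg n (\<lambda>j. r j *\<^sub>R a j)))"

text \<open>Writing \<open>Q\<close> for the form, \<open>Q (v + \<rho> G v) = Q v + 2 \<rho> |G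
  v|^2 + \<rho>^2 Q (G v)\<close>, and both added terms are nonnegative.\<close>

lemma fisher_form_ascent:
  assumes "\<rho> \<ge> 0"
  shows "fisher_form n a v \<le> fisher_form n a (v + \<rho> *\<^sub>R sample_avg n (\<lambda>i. (a i \<bullet> v) *\<^sub>R a i))"
proof -
  let ?G = "sample_avg n (\<lambda>i. (a i \<bullet> v) *\<^sub>R a i)"
  have "?G \<bullet> ?G = sample_avg n (\<lambda>k. (a k \<bullet> v) * (a k \<bullet> ?G))"
    unfolding inner_sample_avg_right[of ?G] by (simp add: inner_commute)
  then have "fisher_form n a v \<le> sample_avg n (\<lambda>k. (a k \<bullet> v)\<^sup>2 + 2 * \<rho> * ((a k \<bullet> v) * (a k \<bullet> ?G)))"
    using assms by (simp add: fisher_form_def sample_avg_add sample_avg_cmult flip: \<open>?G \<bullet> ?G = _\<close>)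
  also have "\<dots> \<le> fisher_form n a (v + \<rho> *\<^sub>R ?G)"
    unfolding fisher_form_def
    by (intro sample_avg_mono) (simp add: inner_add_right power2_sum mult_ac)
  finally show ?thesis .
qed

text \<open>The empirical Fisher matrix of the batch applied to \<open>v\<close>.\<close>

definition batch_grad :: "(nat \<Rightarrow> 'a :: real_inner) \<Rightarrow> nat list \<Rightarrow> 'a \<Rightarrow> 'a" where
  "batch_grad a \<xi> v = (1 / real (length \<xi>)) *\<^sub>R (\<Sum>i\<leftarrow>\<xi>. (a i \<bullet> v) *\<^sub>R a i)"

text \<open>Replacing \<open>s\<close> by \<open>s / B\<close> frees the mean term of
  \<open>B\<close> and turns the variance factor \<open>s^2 B\<close> into
  \<open>s^2 / B\<close>.\<close>

lemma expectation_batch_grad: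
  assumes "n \<ge> 1" "B \<ge> 1"
  shows "measure_pmf.expectation (batch_pmf n B) (\<lambda>\<xi>. fisher_form n a (u + s *\<^sub>R batch_grad a \<xi> w)) =
         fisher_form n a (u + s *\<^sub>R sample_avg n (\<lambda>i. (a i \<bullet> w) *\<^sub>R a i)) +
         s\<^sup>2 / real B * noise_energy n a (\<lambda>i. a i \<bullet> w)"
proof -
  have "measure_pmf.expectation (batch_pmf n B) (\<lambda>\<xi>. fisher_form n a (u + s *\<^sub>R batch_grad a \<xi> w)) =
        measure_pmf.expectation (batch_pmf n B)
          (\<lambda>\<xi>. fisher_form n a (u + (s / real B) *\<^sub>R (\<Sum>i\<leftarrow>\<xi>. (a i \<bullet> w) *\<^sub>R a i)))"
    by (intro integral_cong_AE) (auto simp: AE_measure_pmf_iff set_batch_pmf[OF assms(1)] batch_grad_def)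
  then show ?thesis
    using assms by (simp add: expectation_batch_fisher_form noise_energy_def power2_eq_square)
qed

text \<open>The outer batch contributes the factor \<open>\<eta>^2 / B * \<kappa>\<close> at the
  perturbed point, the inner batch the factor \<open>1 + \<rho>^2 / B * \<kappa>\<close> at
  \<open>v\<close>. In the application \<open>\<kappa>\<close> is \<open>\<gamma>\<close> times the
  squared Frobenius norm.\<close>

lemma expectation_sam_step_ge:
  assumes "n \<ge> 1" "B \<ge> 1" "\<rho> \<ge> 0" "\<kappa> \<ge> 0"
    and noise: "\<And>w. \<kappa> * fisher_form n a w \<le> noise_energy n a (\<lambda>i. a i \<bullet> w)"
  shows "\<eta>\<^sup>2 / real B * \<kappa> * (1 + \<rho>\<^sup>2 / real B * \<kappa>) * fisher_form n a v \<le>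
         measure_pmf.expectation (pair_pmf (batch_pmf n B) (batch_pmf n B))
           (\<lambda>\<xi>. fisher_form n a (v - \<eta> *\<^sub>R batch_grad a (fst \<xi>) (v + \<rho> *\<^sub>R batch_grad a (snd \<xi>) v)))"
proof -
  let ?E = "measure_pmf.expectation (batch_pmf n B)"
  note fin = finite_set_batch_pmf[OF \<open>n \<ge> 1\<close>, of B]
  have "(1 + \<rho>\<^sup>2 / real B * \<kappa>) * fisher_form n a v =
        fisher_form n a v + \<rho>\<^sup>2 / real B * (\<kappa> * fisher_form n a v)"
    by (simp add: algebra_simps)
  \<comment> \<open>For the inner batch both parts count: the mean by
    \<open>fisher_form_ascent\<close>, the fluctuation by \<open>noise\<close>.\<close>
  also have "\<dots> \<le> ?E (\<lambda>\<xi>. fisher_form n a (v + \<rho> *\<^sub>R batch_grad a \<xi> v))"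
    unfolding expectation_batch_grad[OF assms(1,2)]
    by (intro add_mono fisher_form_ascent mult_left_mono noise) (use assms in auto)
  finally have "\<eta>\<^sup>2 / real B * \<kappa> * ((1 + \<rho>\<^sup>2 / real B * \<kappa>) * fisher_form n a v) \<le>
      \<eta>\<^sup>2 / real B * \<kappa> * ?E (\<lambda>\<xi>. fisher_form n a (v + \<rho> *\<^sub>R batch_grad a \<xi> v))"
    by (intro mult_left_mono) (use assms in auto)
  also have "\<dots> = ?E (\<lambda>\<xi>. \<eta>\<^sup>2 / real B * (\<kappa> * fisher_form n a (v + \<rho> *\<^sub>R batch_grad a \<xi> v)))"
    by (simp add: mult.assoc)
  also have "\<dots> \<le> ?E (\<lambda>\<xi>2. ?E (\<lambda>\<xi>1. fisher_form n a (v - \<eta> *\<^sub>R batch_grad a \<xi>1 (v + \<rho> *\<^sub>R batch_grad a \<xi>2 v))))"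
  proof (intro integral_mono integrable_measure_pmf_finite fin)
    fix \<xi>2
    let ?w = "v + \<rho> *\<^sub>R batch_grad a \<xi>2 v"
    have "\<eta>\<^sup>2 / real B * (\<kappa> * fisher_form n a ?w) \<le> \<eta>\<^sup>2 / real B * noise_energy n a (\<lambda>i. a i \<bullet> ?w)"
      by (intro mult_left_mono noise) auto
    \<comment> \<open>The mean part, the form at \<open>v - \<eta> G ?w\<close>, is nonnegative and
      is discarded.\<close>
    also have "\<dots> \<le> ?E (\<lambda>\<xi>1. fisher_form n a (v + (- \<eta>) *\<^sub>R batch_grad a \<xi>1 ?w))"
      unfolding expectation_batch_grad[OF assms(1,2)] by (simp add: fisher_form_nonneg)
    finally show "\<eta>\<^sup>2 / real B * (\<kappa> * fisher_form n a ?w) \<le> ?E (\<lambda>\<xi>1. fisher_form n a (v - \<eta> *\<^sub>R batch_grad a \<xi>1 ?w))"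
      by simp
  qed
  finally show ?thesis
    by (simp add: expectation_pair_pmf_finite[OF fin fin] mult_ac)
qed

subsection \<open>Gradients and linearization\<close>

lemma gradient_eqI:
  assumes "GDERIV F \<theta> :> D"
  shows "gradient F \<theta> = D"
  unfolding gradient_def
proof (rule the_equality[of "\<lambda>D. GDERIV F \<theta> :> D", OF assms])
  fix D' assume "GDERIV F \<theta> :> D'"
  then have "(\<lambda>h. h \<bullet> D') = (\<lambda>h. h \<bullet> D)"
    using assms by (auto simp: gderiv_def intro: has_derivative_unique)
  then show "D' = D" by (metis vector_eq_ldot)
qed

text \<open>Riesz representation: the derivative \<open>F'\<close> is the inner product with
  \<open>adjoint F' 1\<close>.\<close>

lemma gderiv_gradient:
  assumes "F differentiable (at \<theta>)"
  shows "GDERIV F \<theta> :> gradient F \<theta>"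
proof -
  obtain F' where F': "(F has_derivative F') (at \<theta>)"
    using assms by (auto simp: differentiable_def)
  have "F' = (\<lambda>h. h \<bullet> adjoint F' 1)"
    using adjoint_works[OF has_derivative_linear[OF F'], of _ 1] by (auto simp: inner_commute)
  with F' have "GDERIV F \<theta> :> adjoint F' 1"
    unfolding gderiv_def by simp
  then show ?thesis using gradient_eqI by metis
qed

lemma gderiv_sample_avg:
  assumes "\<And>i. i \<in> {1..n} \<Longrightarrow> GDERIV (g i) \<theta> :> D i"
  shows "GDERIV (\<lambda>\<theta>. sample_avg n (\<lambda>i. g i \<theta>)) \<theta> :> sample_avg n D"
  unfolding gderiv_def inner_sample_avg_right
  unfolding sample_avg_def
  by (intro has_derivative_scaleR_right has_derivative_sum) (use assms in \<open>simp add: gderiv_def\<close>)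

lemma gderiv_sum_list:
  assumes "\<And>i. i \<in> set \<xi> \<Longrightarrow> GDERIV (g i) \<theta> :> D i"
  shows "GDERIV (\<lambda>\<theta>. \<Sum>i\<leftarrow>\<xi>. g i \<theta>) \<theta> :> (\<Sum>i\<leftarrow>\<xi>. D i)"
  using assms by (induction \<xi>) (auto simp: GDERIV_const GDERIV_add)

lemma gderiv_sample_loss:
  assumes "GDERIV (f (x i)) \<theta> :> D"
  shows "GDERIV (sample_loss f x y i) \<theta> :> (f (x i) \<theta> - y i) *\<^sub>R D"
  using assms unfolding gderiv_def sample_loss_def power2_abs
  by (auto intro!: derivative_eq_intros simp: fun_eq_iff)

section \<open>Trace of the noise covariance against the Fisher matrix\<close>

lemma loss_eq: "loss n f x y \<theta> = 1 / 2 * sample_avg n (\<lambda>i. (f (x i) \<theta> - y i)\<^sup>2)"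
  by (simp add: loss_def sample_loss_def sample_avg_def sum_divide_distrib mult.commute)

lemma fisher_matrix_eq:
  "fisher_matrix n f x \<theta> = sample_avg n (\<lambda>i. outer_prod (gradient (f (x i)) \<theta>) (gradient (f (x i)) \<theta>))"
  by (simp add: fisher_matrix_def sample_avg_def)

text \<open>For rank-one matrices the trace of \<open>u u^T v v^T\<close> is
  \<open>(v, u)^2\<close>; bilinearity extends this to averages.\<close>

lemma trace_sample_avg_outer_prod:
  fixes u v :: "nat \<Rightarrow> real ^ 'p"
  shows "trace (sample_avg n (\<lambda>i. outer_prod (u i) (u i)) ** sample_avg m (\<lambda>k. outer_prod (v k) (v k))) =
         sample_avg n (\<lambda>i. sample_avg m (\<lambda>k. (v k \<bullet> u i)\<^sup>2))"
proof -
  have entry: "sample_avg l (\<lambda>i. outer_prod (w i) (w i)) $ p $ q = sample_avg l (\<lambda>i. w i $ p * w i $ q)"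
    for l p q and w :: "nat \<Rightarrow> real ^ 'p"
    by (simp add: sample_avg_def outer_prod_def)
  have prod: "sample_avg n g * sample_avg m h = sample_avg n (\<lambda>i. sample_avg m (\<lambda>k. g i * h k))"
    for g h :: "nat \<Rightarrow> real"
    by (simp add: sample_avg_def sum_product sum_divide_distrib mult.commute)
  have "trace (sample_avg n (\<lambda>i. outer_prod (u i) (u i)) ** sample_avg m (\<lambda>k. outer_prod (v k) (v k))) =
      (\<Sum>p\<in>UNIV. \<Sum>q\<in>UNIV. sample_avg n (\<lambda>i. sample_avg m (\<lambda>k. (u i $ p * u i $ q) * (v k $ q * v k $ p))))"
    by (simp add: trace_def matrix_matrix_mult_def entry prod)
  also have "\<dots> = sample_avg n (\<lambda>i. sample_avg m (\<lambda>k. \<Sum>p\<in>UNIV. \<Sum>q\<in>UNIV. (u i $ p * u i $ q) * (v k $ q * v k $ p)))"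
  proof -
    have sw: "(\<Sum>p\<in>A. sample_avg l (g p)) = sample_avg l (\<lambda>k. \<Sum>p\<in>A. g p k)"
      for l and A :: "'p set" and g :: "'p \<Rightarrow> nat \<Rightarrow> real"
      unfolding sample_avg_def by (subst sum.swap) (simp add: sum_divide_distrib)
    show ?thesis by (simp add: sw)
  qed
  also have "\<dots> = sample_avg n (\<lambda>i. sample_avg m (\<lambda>k. (v k \<bullet> u i)\<^sup>2))"
    by (simp add: inner_vec_def power2_eq_square sum_product mult_ac)
  finally show ?thesis .
qed

text \<open>The gradient of a sample loss is residual times model gradient, so the noise covariance
  averages rank-one matrices and the trace formula applies.\<close>

lemma trace_noise_fisher:
  assumes "\<And>i. i \<in> {1..n} \<Longrightarrow> f (x i) differentiable (at \<theta>)"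
  shows "trace (noise_covariance n f x y \<theta> ** fisher_matrix n f x \<theta>) =
         noise_energy n (\<lambda>i. gradient (f (x i)) \<theta>) (\<lambda>i. f (x i) \<theta> - y i)"
proof -
  define a where "a i = gradient (f (x i)) \<theta>" for i
  define b where "b i = (f (x i) \<theta> - y i) *\<^sub>R a i" for i
  have g: "GDERIV (sample_loss f x y i) \<theta> :> b i" if "i \<in> {1..n}" for i
    unfolding a_def b_def by (intro gderiv_sample_loss gderiv_gradient assms that)
  have "GDERIV (loss n f x y) \<theta> :> sample_avg n b"
    using gderiv_sample_avg[of n "sample_loss f x y", OF g]
    by (simp add: loss_def[abs_def] sample_avg_def)
  then have "noise_covariance n f x y \<theta> =
      sample_avg n (\<lambda>i. outer_prod (b i - sample_avg n b) (b i - sample_avg n b))"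
    unfolding noise_covariance_def sample_avg_def[symmetric]
    by (intro sample_avg_cong) (simp only: gradient_eqI gradient_eqI[OF g])
  then show ?thesis
    by (simp add: fisher_matrix_eq trace_sample_avg_outer_prod noise_energy_def fisher_form_def
                  b_def[abs_def] a_def)
qed

section \<open>Limit of the noise condition at the minimum\<close>

lemma tendsto_sample_avg [tendsto_intros]:
  fixes l :: "nat \<Rightarrow> 'b :: real_normed_vector"
  shows "(\<And>i. i \<in> {1..n} \<Longrightarrow> ((\<lambda>z. g z i) \<longlongrightarrow> l i) F) \<Longrightarrow>
         ((\<lambda>z. sample_avg n (g z)) \<longlongrightarrow> sample_avg n l) F"
  unfolding sample_avg_def by (intro tendsto_intros)

lemma tendsto_noise_energy:
  assumes "\<And>i. i \<in> {1..n} \<Longrightarrow> ((\<lambda>z. a z i) \<longlongrightarrow> a' i) F"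
    and "\<And>i. i \<in> {1..n} \<Longrightarrow> ((\<lambda>z. r z i) \<longlongrightarrow> r' i) F"
  shows "((\<lambda>z. noise_energy n (a z) (r z)) \<longlongrightarrow> noise_energy n a' r') F"
  unfolding noise_energy_def fisher_form_def by (intro tendsto_intros assms)

lemma tendsto_frobenius_fisher:
  fixes a :: "'z \<Rightarrow> nat \<Rightarrow> real ^ 'p"
  assumes "\<And>i. i \<in> {1..n} \<Longrightarrow> ((\<lambda>z. a z i) \<longlongrightarrow> a' i) F"
  shows "((\<lambda>z. frobenius_norm (sample_avg n (\<lambda>i. outer_prod (a z i) (a z i)))) \<longlongrightarrow>
          frobenius_norm (sample_avg n (\<lambda>i. outer_prod (a' i) (a' i)))) F"
  unfolding frobenius_norm_def outer_prod_def by (intro tendsto_intros tendsto_vec_lambda assms)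

lemma noise_energy_scale: "noise_energy n a (\<lambda>i. c * r i) = c\<^sup>2 * noise_energy n a r"
proof -
  have "sample_avg n (\<lambda>j. (c * r j) *\<^sub>R a j) = c *\<^sub>R sample_avg n (\<lambda>j. r j *\<^sub>R a j)"
    by (simp add: sample_avg_def scaleR_sum_right mult_ac)
  then have "(c * r i) *\<^sub>R a i - sample_avg n (\<lambda>j. (c * r j) *\<^sub>R a j) =
      c *\<^sub>R (r i *\<^sub>R a i - sample_avg n (\<lambda>j. r j *\<^sub>R a j))" for i
    by (simp add: scaleR_diff_right)
  then show ?thesis
    by (simp add: noise_energy_def fisher_form_def power_mult_distrib sample_avg_cmult)
qed

text \<open>As \<open>c\<close> is the value at \<open>\<theta>\<close>, this is a difference
  quotient along the direction \<open>v\<close>.\<close>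

lemma residual_quotient_tendsto:
  assumes "GDERIV F \<theta> :> D" "F \<theta> = c"
  shows "((\<lambda>s. 1 / s * (F (\<theta> + s *\<^sub>R v) - c)) \<longlongrightarrow> D \<bullet> v) (at (0::real))"
proof -
  have "((\<lambda>s. \<theta> + s *\<^sub>R v) has_derivative (\<lambda>s. s *\<^sub>R v)) (at 0)"
    by (auto intro!: derivative_eq_intros)
  moreover have "(F has_derivative (\<lambda>h. h \<bullet> D)) (at (\<theta> + 0 *\<^sub>R v))"
    using assms by (simp add: gderiv_def)
  ultimately have "((\<lambda>s. F (\<theta> + s *\<^sub>R v)) has_derivative (\<lambda>s. (s *\<^sub>R v) \<bullet> D)) (at 0)"
    by (rule has_derivative_compose)
  then have "((\<lambda>s. F (\<theta> + s *\<^sub>R v)) has_real_derivative D \<bullet> v) (at 0)"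
    unfolding has_field_derivative_def
    by (rule has_derivative_eq_rhs) (simp add: fun_eq_iff inner_commute mult.commute)
  then show ?thesis
    using assms by (simp add: has_field_derivative_iff)
qed

text \<open>
  The noise condition is quadratic in the residuals, so dividing it by \<open>s\<^sup>2\<close> at
  \<open>\<theta>s + s v\<close> and letting \<open>s\<close> tend to \<open>0\<close> transfers it to the linearized model.
\<close>

lemma linearized_noise_condition:
  fixes f :: "'x \<Rightarrow> real ^ 'p \<Rightarrow> real"
  assumes diff: "\<And>i. i \<in> {1..n} \<Longrightarrow> twice_differentiable (f (x i))"
    and interp: "\<And>i. i \<in> {1..n} \<Longrightarrow> f (x i) \<theta>s = y i"
    and noise: "\<And>\<theta>. 2 * \<gamma> * loss n f x y \<theta> * (frobenius_norm (fisher_matrix n f x \<theta>))\<^sup>2 \<le>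
               trace (noise_covariance n f x y \<theta> ** fisher_matrix n f x \<theta>)"
  shows "\<gamma> * (frobenius_norm (fisher_matrix n f x \<theta>s))\<^sup>2 * fisher_form n (\<lambda>i. gradient (f (x i)) \<theta>s) v \<le>
         noise_energy n (\<lambda>i. gradient (f (x i)) \<theta>s) (\<lambda>i. gradient (f (x i)) \<theta>s \<bullet> v)"
proof -
  define \<theta> where "\<theta> s = \<theta>s + s *\<^sub>R v" for s
  define a where "a s i = gradient (f (x i)) (\<theta> s)" for s i
  define r where "r s i = 1 / s * (f (x i) (\<theta> s) - y i)" for s i
  define a' where "a' i = gradient (f (x i)) \<theta>s" for i
  define N where "N b = (frobenius_norm (sample_avg n (\<lambda>i. outer_prod (b i) (b i))))\<^sup>2"
    for b :: "nat \<Rightarrow> real ^ 'p"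
  have a: "((\<lambda>s. a s i) \<longlongrightarrow> a' i) (at 0)" if "i \<in> {1..n}" for i
  proof -
    have "isCont (gradient (f (x i))) \<theta>s"
      \<comment> \<open>Differentiability of the gradient supplies its continuity.\<close>
      using diff[OF that] by (auto simp: twice_differentiable_def intro: differentiable_imp_continuous_within)
    moreover have "(\<theta> \<longlongrightarrow> \<theta>s) (at 0)"
      unfolding \<theta>_def by (auto intro!: tendsto_eq_intros)
    ultimately show ?thesis
      unfolding a_def a'_def by (rule isCont_tendsto_compose)
  qed
  have r: "((\<lambda>s. r s i) \<longlongrightarrow> a' i \<bullet> v) (at 0)" if "i \<in> {1..n}" for i
    unfolding r_def a'_def \<theta>_def
    by (rule residual_quotient_tendsto)
       (use diff[OF that] interp[OF that] in \<open>auto simp: twice_differentiable_def intro: gderiv_gradient\<close>)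
  have "\<gamma> * N a' * sample_avg n (\<lambda>i. (a' i \<bullet> v)\<^sup>2) \<le> noise_energy n a' (\<lambda>i. a' i \<bullet> v)"
  proof (rule tendsto_le)
    show "((\<lambda>s. noise_energy n (a s) (r s)) \<longlongrightarrow> noise_energy n a' (\<lambda>i. a' i \<bullet> v)) (at 0)"
      by (intro tendsto_noise_energy a r)
    show "((\<lambda>s. \<gamma> * N (a s) * sample_avg n (\<lambda>i. (r s i)\<^sup>2)) \<longlongrightarrow>
           \<gamma> * N a' * sample_avg n (\<lambda>i. (a' i \<bullet> v)\<^sup>2)) (at 0)"
      unfolding N_def by (intro tendsto_intros tendsto_frobenius_fisher a r)
    have "\<gamma> * N (a s) * sample_avg n (\<lambda>i. (r s i)\<^sup>2) \<le> noise_energy n (a s) (r s)" for s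
    proof -
      have "trace (noise_covariance n f x y (\<theta> s) ** fisher_matrix n f x (\<theta> s)) =
            noise_energy n (a s) (\<lambda>i. f (x i) (\<theta> s) - y i)"
        unfolding a_def using diff by (intro trace_noise_fisher) (auto simp: twice_differentiable_def)
      with noise[of "\<theta> s"]
      have "\<gamma> * sample_avg n (\<lambda>i. (f (x i) (\<theta> s) - y i)\<^sup>2) * N (a s) \<le>
            noise_energy n (a s) (\<lambda>i. f (x i) (\<theta> s) - y i)"
        by (simp add: loss_eq N_def fisher_matrix_eq a_def)
      \<comment> \<open>At \<open>s = 0\<close> the convention \<open>1 / 0 = 0\<close> makes both
        sides vanish, so the inequality holds for every \<open>s\<close>.\<close>
      from mult_left_mono[OF this, of "(1 / s)\<^sup>2"]
      show ?thesis
        unfolding r_def noise_energy_scale power_mult_distrib sample_avg_cmult by (simp add: mult_ac)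
    qed
    then show "\<forall>\<^sub>F s in at 0. \<gamma> * N (a s) * sample_avg n (\<lambda>i. (r s i)\<^sup>2) \<le> noise_energy n (a s) (r s)"
      by simp
  qed simp
  then show ?thesis
    unfolding N_def fisher_matrix_eq fisher_form_def a'_def .
qed

section \<open>Stochastic SAM on the linearized loss\<close>

lemma gradient_linearized_batch_loss:
  assumes "\<And>i. i \<in> {1..n} \<Longrightarrow> f (x i) \<theta>s = y i" and "set \<xi> \<subseteq> {1..n}"
  shows "gradient (batch_loss (sample_loss (linearized_model f \<theta>s) x y) \<xi>) \<theta> =
         batch_grad (\<lambda>i. gradient (f (x i)) \<theta>s) \<xi> (\<theta> - \<theta>s)"
proof (rule gradient_eqI)
  let ?a = "\<lambda>i. gradient (f (x i)) \<theta>s"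
  have "GDERIV (sample_loss (linearized_model f \<theta>s) x y i) \<theta> :> (?a i \<bullet> (\<theta> - \<theta>s)) *\<^sub>R ?a i"
    if "i \<in> set \<xi>" for i
  proof -
    have "GDERIV (linearized_model f \<theta>s (x i)) \<theta> :> ?a i"
      unfolding gderiv_def linearized_model_def
      by (auto intro!: derivative_eq_intros simp: inner_commute)
    from gderiv_sample_loss[of "linearized_model f \<theta>s" x, OF this, of y]
    \<comment> \<open>By interpolation the residual of the linearized model at
      \<open>\<theta>\<close> is \<open>?a i \<bullet> (\<theta> - \<theta>s)\<close>.\<close>
    show ?thesis using that assms by (auto simp: linearized_model_def)
  qed
  from gderiv_sum_list[of \<xi>, OF this]
  have "GDERIV (\<lambda>\<theta>. \<Sum>i\<leftarrow>\<xi>. sample_loss (linearized_model f \<theta>s) x y i \<theta>) \<theta> :>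
          (\<Sum>i\<leftarrow>\<xi>. (?a i \<bullet> (\<theta> - \<theta>s)) *\<^sub>R ?a i)" .
  from GDERIV_mult[OF GDERIV_const[of "1 / real (length \<xi>)"] this]
  show "GDERIV (batch_loss (sample_loss (linearized_model f \<theta>s) x y) \<xi>) \<theta> :>
          batch_grad ?a \<xi> (\<theta> - \<theta>s)"
    by (simp add: batch_loss_def[abs_def] batch_grad_def)
qed

lemma loss_linearized:
  assumes "\<And>i. i \<in> {1..n} \<Longrightarrow> f (x i) \<theta>s = y i"
  shows "loss n (linearized_model f \<theta>s) x y \<theta> =
         1 / 2 * fisher_form n (\<lambda>i. gradient (f (x i)) \<theta>s) (\<theta> - \<theta>s)"
  unfolding loss_eq fisher_form_def
  by (intro arg_cong[of _ _ "(*) _"] sample_avg_cong) (use assms in \<open>simp add: linearized_model_def\<close>)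

lemma loss_eq_0_iff:
  assumes "n \<ge> 1"
  shows "loss n f x y \<theta> = 0 \<longleftrightarrow> (\<forall>i\<in>{1..n}. f (x i) \<theta> = y i)"
  using assms by (auto simp: loss_eq sample_avg_def sum_nonneg_eq_0_iff)

definition sam_step ::
  "(nat \<Rightarrow> real ^ 'p \<Rightarrow> real) \<Rightarrow> real \<Rightarrow> real \<Rightarrow> real ^ 'p \<Rightarrow> nat list \<times> nat list \<Rightarrow> real ^ 'p" where
  "sam_step ls \<eta> \<rho> \<theta> \<xi> =
     \<theta> - \<eta> *\<^sub>R gradient (batch_loss ls (fst \<xi>)) (\<theta> + \<rho> *\<^sub>R gradient (batch_loss ls (snd \<xi>)) \<theta>)"

lemma sam_iterate_eq_random_orbit:
  "sam_iterate ls \<eta> \<rho> \<theta> \<omega> t = random_orbit (sam_step ls \<eta> \<rho>) \<theta> \<omega> t"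
  by (induction t) (simp_all add: sam_step_def Let_def)

text \<open>In the displacement from \<open>\<theta>s\<close> the linearized loss is half the Fisher
  form and a SAM step is the map of \<open>expectation_sam_step_ge\<close>, whose bound
  \<open>expectation_random_orbit_ge\<close> iterates.\<close>

lemma expected_lin_loss_ge:
  fixes f :: "'x \<Rightarrow> real ^ 'p \<Rightarrow> real"
  assumes "n \<ge> 1" "B \<ge> 1" "\<rho> \<ge> 0" "\<kappa> \<ge> 0"
    and interp: "\<And>i. i \<in> {1..n} \<Longrightarrow> f (x i) \<theta>s = y i"
    and noise: "\<And>v. \<kappa> * fisher_form n (\<lambda>i. gradient (f (x i)) \<theta>s) v \<le>
         noise_energy n (\<lambda>i. gradient (f (x i)) \<theta>s) (\<lambda>i. gradient (f (x i)) \<theta>s \<bullet> v)"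
  shows "(\<eta>\<^sup>2 / real B * \<kappa> * (1 + \<rho>\<^sup>2 / real B * \<kappa>)) ^ t * loss n (linearized_model f \<theta>s) x y \<theta>0 \<le>
         expected_lin_loss n f x y \<theta>s \<eta> \<rho> B \<theta>0 t"
  unfolding expected_lin_loss_def batch_space_def sam_iterate_eq_random_orbit
proof (rule expectation_random_orbit_ge)
  let ?p = "pair_pmf (batch_pmf n B) (batch_pmf n B)"
  let ?a = "\<lambda>i. gradient (f (x i)) \<theta>s"
  let ?L = "loss n (linearized_model f \<theta>s) x y"
  let ?h = "sam_step (sample_loss (linearized_model f \<theta>s) x y) \<eta> \<rho>"
  let ?C = "\<eta>\<^sup>2 / real B * \<kappa> * (1 + \<rho>\<^sup>2 / real B * \<kappa>)"
  have lin: "?L \<theta> = 1 / 2 * fisher_form n ?a (\<theta> - \<theta>s)" for \<theta>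
    by (rule loss_linearized) (rule interp)
  have grad: "gradient (batch_loss (sample_loss (linearized_model f \<theta>s) x y) \<xi>) \<theta> =
      batch_grad ?a \<xi> (\<theta> - \<theta>s)" if "set \<xi> \<subseteq> {1..n}" for \<xi> \<theta>
    by (rule gradient_linearized_batch_loss[OF _ that]) (rule interp)
  show "finite (set_pmf ?p)"
    using finite_set_batch_pmf[OF \<open>n \<ge> 1\<close>] by simp
  show "0 \<le> ?L \<theta>" for \<theta>
    by (simp add: lin fisher_form_nonneg)
  show "0 \<le> ?C" using assms by simp
  show "?C * ?L \<theta> \<le> measure_pmf.expectation ?p (\<lambda>\<xi>. ?L (?h \<theta> \<xi>))" for \<theta>
  proof -
    \<comment> \<open>Restricted to the support, since interpolation is known for indices in
      \<open>{1..n}\<close>.\<close>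
    have h: "?h \<theta> \<xi> - \<theta>s = (\<theta> - \<theta>s) -
        \<eta> *\<^sub>R batch_grad ?a (fst \<xi>) ((\<theta> - \<theta>s) + \<rho> *\<^sub>R batch_grad ?a (snd \<xi>) (\<theta> - \<theta>s))"
      if "\<xi> \<in> set_pmf ?p" for \<xi>
    proof -
      from that have "set (fst \<xi>) \<subseteq> {1..n}" "set (snd \<xi>) \<subseteq> {1..n}"
        by (auto simp: set_batch_pmf[OF \<open>n \<ge> 1\<close>])
      then show ?thesis
        by (simp add: sam_step_def grad algebra_simps)
    qed
    have "?C * ?L \<theta> = 1 / 2 * (?C * fisher_form n ?a (\<theta> - \<theta>s))"
      by (simp add: lin del: times_divide_eq_left times_divide_eq_right)
    also have "\<dots> \<le> 1 / 2 * measure_pmf.expectation ?p (\<lambda>\<xi>. fisher_form n ?a ((\<theta> - \<theta>s) -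
        \<eta> *\<^sub>R batch_grad ?a (fst \<xi>) ((\<theta> - \<theta>s) + \<rho> *\<^sub>R batch_grad ?a (snd \<xi>) (\<theta> - \<theta>s))))"
      by (intro mult_left_mono expectation_sam_step_ge assms) simp
    also have "\<dots> = measure_pmf.expectation ?p (\<lambda>\<xi>. ?L (?h \<theta> \<xi>))"
      unfolding integral_mult_right_zero[symmetric]
      by (intro integral_cong_AE) (auto simp: AE_measure_pmf_iff lin h)
    finally show ?thesis .
  qed
qed

lemma expected_lin_loss_0:
  "expected_lin_loss n f x y \<theta>s \<eta> \<rho> B \<theta>0 0 = loss n (linearized_model f \<theta>s) x y \<theta>0"
proof -
  interpret sequence_space "measure_pmf (pair_pmf (batch_pmf n B) (batch_pmf n B))" by unfold_locales
  show ?thesis by (simp add: expected_lin_loss_def batch_space_def P.prob_space)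
qed

text \<open>Excludes the degenerate case of vanishing initial losses, where growth says nothing. A
  nonzero Fisher matrix has a nonzero sample gradient \<open>a i\<close>, and moving from
  \<open>\<theta>s\<close> along it makes the square with index \<open>i\<close> positive.\<close>

lemma linearized_loss_pos_near:
  fixes f :: "'x \<Rightarrow> real ^ 'p \<Rightarrow> real"
  assumes interp: "\<And>i. i \<in> {1..n} \<Longrightarrow> f (x i) \<theta>s = y i"
    and "fisher_matrix n f x \<theta>s \<noteq> 0" and "open U" "\<theta>s \<in> U"
  obtains \<theta> where "\<theta> \<in> U" "loss n (linearized_model f \<theta>s) x y \<theta> > 0"
proof -
  define a where "a i = gradient (f (x i)) \<theta>s" for i
  have lin: "loss n (linearized_model f \<theta>s) x y \<theta> = 1 / 2 * fisher_form n a (\<theta> - \<theta>s)" for \<theta>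
    unfolding a_def by (rule loss_linearized) (rule interp)
  obtain i where i: "i \<in> {1..n}" "a i \<noteq> 0"
  proof (rule ccontr)
    assume "\<not> thesis"
    with that have "\<And>i. i \<in> {1..n} \<Longrightarrow> a i = 0" by blast
    then have "fisher_matrix n f x \<theta>s = sample_avg n (\<lambda>_. 0)"
      unfolding fisher_matrix_eq
      by (intro sample_avg_cong) (simp add: outer_prod_def vec_eq_iff flip: a_def)
    with assms(2) show False by (simp add: sample_avg_def)
  qed
  obtain e where e: "e > 0" "ball \<theta>s e \<subseteq> U"
    using assms by (auto simp: open_contains_ball)
  \<comment> \<open>Chosen so that the displacement \<open>s *\<^sub>R a i\<close> has norm
    \<open>e / 2\<close>.\<close>
  define s where "s = e / (2 * norm (a i))"
  have "s > 0" using e i by (simp add: s_def)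
  have "\<theta>s + s *\<^sub>R a i \<in> U"
    using e i by (intro subsetD[OF e(2)]) (simp add: s_def dist_norm)
  moreover have "0 < (\<Sum>k = 1..n. (a k \<bullet> (s *\<^sub>R a i))\<^sup>2)"
    using i \<open>s > 0\<close> by (intro sum_pos2[of _ i]) auto
  then have "loss n (linearized_model f \<theta>s) x y (\<theta>s + s *\<^sub>R a i) > 0"
    using i by (simp add: lin fisher_form_def sample_avg_def)
  ultimately show thesis by (rule that)
qed

theorem corollary4p2:
  fixes f :: "real ^ 'd \<Rightarrow> real ^ 'p \<Rightarrow> real"
    and x :: "nat \<Rightarrow> real ^ 'd" and y :: "nat \<Rightarrow> real"
    and n B :: nat and \<eta> \<rho> \<gamma> :: real and \<theta>s :: "real ^ 'p"
  assumes "n \<ge> 1"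
    and "\<And>i. i \<in> {1..n} \<Longrightarrow> twice_differentiable (f (x i))"
    and "is_arg_min (loss n f x y) (\<lambda>_. True) \<theta>s" and "loss n f x y \<theta>s = 0"
    and "\<eta> > 0" and "\<rho> \<ge> 0" and "B \<ge> 1" and "\<gamma> > 0"
    and "\<And>\<theta>. trace (noise_covariance n f x y \<theta> ** fisher_matrix n f x \<theta>)
               \<ge> 2 * \<gamma> * loss n f x y \<theta> * (frobenius_norm (fisher_matrix n f x \<theta>))\<^sup>2"
    and "(frobenius_norm (loss_hessian n f x y \<theta>s))\<^sup>2 *
           (1 + \<rho>\<^sup>2 * \<gamma> / real B * (frobenius_norm (loss_hessian n f x y \<theta>s))\<^sup>2)
         > real B / (\<eta>\<^sup>2 * \<gamma>)"
  shows "\<not> linearly_stable n f x y \<theta>s \<eta> \<rho> B \<and>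
         (\<exists>C>1. \<forall>\<theta>0. \<forall>t>0. expected_lin_loss n f x y \<theta>s \<eta> \<rho> B \<theta>0 t
                           \<ge> C ^ t * expected_lin_loss n f x y \<theta>s \<eta> \<rho> B \<theta>0 0)"
proof -
  have interp: "f (x i) \<theta>s = y i" if "i \<in> {1..n}" for i
    using assms(1,4) that by (simp add: loss_eq_0_iff)
  have hess: "loss_hessian n f x y \<theta>s = fisher_matrix n f x \<theta>s"
    using interp by (simp add: loss_hessian_def)
  define N where "N = (frobenius_norm (fisher_matrix n f x \<theta>s))\<^sup>2"
  \<comment> \<open>The one-step factor with \<open>\<kappa> = \<gamma> * N\<close>; the assumed
    inequality, multiplied by \<open>\<eta>^2 \<gamma> / B\<close>, says exactly that
    \<open>C > 1\<close>.\<close>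
  define C where "C = \<eta>\<^sup>2 / real B * (\<gamma> * N) * (1 + \<rho>\<^sup>2 / real B * (\<gamma> * N))"
  have gt: "real B / (\<eta>\<^sup>2 * \<gamma>) < N * (1 + \<rho>\<^sup>2 * \<gamma> / real B * N)"
    using assms(10) by (simp add: hess N_def)
  have "1 = \<eta>\<^sup>2 * \<gamma> / real B * (real B / (\<eta>\<^sup>2 * \<gamma>))" using assms by simp
  also have "\<dots> < \<eta>\<^sup>2 * \<gamma> / real B * (N * (1 + \<rho>\<^sup>2 * \<gamma> / real B * N))"
    using assms by (intro mult_strict_left_mono gt) simp
  also have "\<dots> = C" by (simp add: C_def mult_ac)
  finally have "C > 1" .
  have growth: "C ^ t * expected_lin_loss n f x y \<theta>s \<eta> \<rho> B \<theta>0 0 \<le>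
                expected_lin_loss n f x y \<theta>s \<eta> \<rho> B \<theta>0 t" for \<theta>0 t
    unfolding C_def N_def expected_lin_loss_0
    by (intro expected_lin_loss_ge linearized_noise_condition[where y = y] assms interp)
       (use assms in simp_all)
  have "\<not> linearly_stable n f x y \<theta>s \<eta> \<rho> B"
  proof
    assume "linearly_stable n f x y \<theta>s \<eta> \<rho> B"
    then obtain K U where U: "open U" "\<theta>s \<in> U"
      and K: "\<And>\<theta>0 t. \<theta>0 \<in> U \<Longrightarrow> expected_lin_loss n f x y \<theta>s \<eta> \<rho> B \<theta>0 t
                      \<le> K * expected_lin_loss n f x y \<theta>s \<eta> \<rho> B \<theta>0 0"
      unfolding linearly_stable_def by blast
    \<comment> \<open>Positivity of the left side of \<open>gt\<close> forces \<open>N\<close>,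
      hence the Fisher matrix, to be nonzero.\<close>
    have "real B / (\<eta>\<^sup>2 * \<gamma>) > 0" using assms by simp
    with gt have "fisher_matrix n f x \<theta>s \<noteq> 0"
      by (auto simp: N_def frobenius_norm_def)
    with U interp obtain \<theta>0 where \<theta>0: "\<theta>0 \<in> U" "loss n (linearized_model f \<theta>s) x y \<theta>0 > 0"
      using linearized_loss_pos_near[of n f x \<theta>s y U] by blast
    \<comment> \<open>The positive initial loss at \<open>\<theta>0\<close> cancels, leaving an
      unbounded geometric sequence below a constant.\<close>
    have "C ^ t \<le> K" for t
      using order_trans[OF growth K[OF \<theta>0(1)], of t] \<theta>0(2) by (simp add: expected_lin_loss_0)
    with real_arch_pow[OF \<open>C > 1\<close>, of K] show False
      by (auto simp: not_less[symmetric])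
  qed
  with \<open>C > 1\<close> growth show ?thesis by blast
qed

end
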